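(* Under the standing assumptions (A) of the context, let $\lambda_m$ denote the eigenvalues in $(\lambda_b,+\infty)$ of problem (E), indexed as in the context, and let $\check H_{11},\hat H_{11},\hat H_{22},\underline H_{22},\check h_{22},\hat h_{22}$ be the constants of the context. Then for all sufficiently large $m\in\mathbb N_+$, $$\frac{\hat H_{22}-\underline H_{22}}{\check h_{22}}+\frac{\pi^2m^2}{-2\hat H_{11}\check h_{22}T^2}\le\lambda_m\le\frac{4\pi^2m^2}{-\check H_{11}\hat h_{22}T^2}.$$ Therefore, for all sufficiently large $m\in\mathbb N_+$ and every eigenvalue $\lambda\in(\lambda_b,+\infty)$ of (E): if $$\lambda>\frac{4\pi^2m^2}{-\check H_{11}\hat h_{22}T^2}\qquad\left(\text{resp. } \lambda<\frac{\hat H_{22}-\underline H_{22}}{\check h_{22}}+\frac{\pi^2m^2}{-2\hat H_{11}\check h_{22}T^2}\right),$$ then the statistic period of the eigenfunctions associated with $\lambda$ is greater (resp. less) than $m$.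
   Context: Let $(\Omega,\mathscr F,\mathbb F,\mathbb P)$ be a complete filtered probability space carrying a standard $1$-dimensional Brownian motion $B$, where $\mathbb F$ is the natural filtration of $B$ augmented by the $\mathbb P$-null sets, and let $T>0$. Standing assumptions (A): $H_{ij}\in C([0,T],\mathbb R)$ with $H_{ij}=H_{ji}$, $i,j=1,2,3$; there is $\beta>0$ such that for all $t\in[0,T]$, $(x,y,z)\in\mathbb R^3$ $$\begin{bmatrix}x&y&z\end{bmatrix}\begin{bmatrix}-H_{11}(t)&-H_{12}(t)&-H_{13}(t)\\ H_{21}(t)&H_{22}(t)&H_{23}(t)\\ H_{31}(t)&H_{32}(t)&H_{33}(t)\end{bmatrix}\begin{bmatrix}x\\ y\\ z\end{bmatrix}\le-\beta(x^2+y^2+z^2)$$ (monotonicity condition); $H_{23}(t)=-H_{33}(t)H_{13}(t)$ on $[0,T]$; $h_{22}\in C([0,T],\mathbb R)$, $h_{22}(t)<0$ on $[0,T]$. Problem (E), with parameter $\lambda\in\mathbb R$: $$\begin{cases}dx_t=[H_{21}x_t+(H_{22}-\lambda h_{22})y_t+H_{23}z_t]\,dt+[H_{31}x_t+H_{32}y_t+H_{33}z_t]\,dB_t,& t\in[0,T],\\ -dy_t=[H_{11}x_t+H_{12}y_t+H_{13}z_t]\,dt-z_t\,dB_t,& t\in[0,T],\\ x(0)=0,\quad y(T)=0.\end{cases}$$ Solutions are $\mathbb F$-adapted processes in $M^2(0,T;\mathbb R^3)$ (square-integrable). A real $\lambda$ is an eigenvalue if (E) has a nontrivial solution (an eigenfunction).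 Put $$\lambda_b=\frac{\min_{t\in[0,T]}\{H_{22}(t)-H_{33}(t)H_{13}^2(t)\}}{\max_{t\in[0,T]}h_{22}(t)}>0.$$ Constants: fix constants such that for all $t\in[0,T]$: $0<\check H_{11}<H_{11}(t)<\hat H_{11}$, $\check H_{22}<H_{22}(t)<\hat H_{22}<0$, $0\le\check H_{13}\le|H_{13}(t)|\le\hat H_{13}$, $\check H_{33}<H_{33}(t)<\hat H_{33}<0$, $\check H_{21}\le H_{21}(t)\le\hat H_{21}$, $\check h_{22}<h_{22}(t)<\hat h_{22}<0$. Put $\hat H_{23}=-\check H_{33}\hat H_{13}$ and $\hat H_{12}=\hat H_{21}$, $\hat H_{31}=\hat H_{13}$, $\hat H_{32}=\hat H_{23}$. The constant $\underline H_{22}<0$ is fixed with $-\underline H_{22}$ so large that the constant symmetric matrix $$\begin{bmatrix}\hat H_{11}&\hat H_{12}&\hat H_{13}\\ \hat H_{21}&\underline H_{22}&\hat H_{23}\\ \hat H_{31}&\hat H_{32}&\check H_{33}\end{bmatrix}$$ satisfies the monotonicity condition (for some $\beta>0$). Indexing and statistic period: extend the coefficients to $(-\infty,T]$ by their values at $t=0$ for $t<0$. For $\bar t\le T$ let $k(\cdot;\lambda)$ be the maximal backward solution of $$-\frac{dk}{dt}=(2H_{21}+H_{13}^2)k+H_{11}+(H_{22}-H_{33}H_{13}^2-\lambda h_{22})k^2,\ t\le\bar t,\quad k(\bar t)=0,$$ and $\tilde k(\cdot;\lambda)$ that of $$-\frac{d\tilde k}{dt}=-(2H_{21}+H_{13}^2)\tilde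 k-H_{11}\tilde k^2-(H_{22}-H_{33}H_{13}^2-\lambda h_{22}),\ t\le\bar t,\quad \tilde k(\bar t)=0.$$ Let $t^k_{\lambda,\bar t}=\sup\{t_0<\bar t:\lim_{t\searrow t_0}k(t;\lambda)=+\infty\}$ and $t^{\tilde k}_{\lambda,\bar t}=\sup\{t_0<\bar t:\lim_{t\searrow t_0}\tilde k(t;\lambda)=-\infty\}$ (with $\sup\emptyset=-\infty$). Define $t_0(\lambda)=T$, $t_{2i+1}(\lambda)=t^k_{\lambda,t_{2i}(\lambda)}$ and $t_{2i+2}(\lambda)=t^{\tilde k}_{\lambda,t_{2i+1}(\lambda)}$ for $i\ge0$, as long as these are finite (and $-\infty$ afterwards). Every eigenvalue $\lambda>\lambda_b$ of (E) satisfies $t_{2m-1}(\lambda)=0$ for exactly one $m\in\mathbb N_+$; this $m$ is called the statistic period of the eigenfunctions associated with $\lambda$, and the eigenvalues are indexed so that $\lambda_m$ is the eigenvalue in $(\lambda_b,+\infty)$ with $t_{2m-1}(\lambda_m)=0$ (it exists and is unique for all large $m$). *)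

theory Defs
  imports "HOL-Probability.Probability"
begin

section \<open>Brownian motion and its augmented natural filtration\<close>

locale standard_brownian_motion = prob_space M + complete_measure M
  for M :: "'a measure" +
  fixes B :: "real \<Rightarrow> 'a \<Rightarrow> real"
  assumes random_variable_B: "\<And>t. 0 \<le> t \<Longrightarrow> B t \<in> borel_measurable M"
    and B_zero: "AE \<omega> in M. B 0 \<omega> = 0"
    and independent_increments:
      "\<And>(s :: nat \<Rightarrow> real) n. 0 \<le> s 0 \<Longrightarrow> mono s \<Longrightarrow>
         indep_vars (\<lambda>_. borel) (\<lambda>i \<omega>. B (s (Suc i)) \<omega> - B (s i) \<omega>) {..<n}"
    and normal_increments:
      "\<And>s t. 0 \<le> s \<Longrightarrow> s < t \<Longrightarrow>
         distributed M lborel (\<lambda>\<omega>. B t \<omega> - B s \<omega>) (normal_density 0 (sqrt (t - s)))"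
    and continuous_paths: "AE \<omega> in M. continuous_on {0..} (\<lambda>t. B t \<omega>)"

definition augmented_filtration ::
    "'a measure \<Rightarrow> (real \<Rightarrow> 'a \<Rightarrow> real) \<Rightarrow> real \<Rightarrow> 'a measure" where
  "augmented_filtration M B t =
     sigma (space M)
       ((\<Union>s\<in>{0..t}. {B s -` A \<inter> space M | A. A \<in> sets borel}) \<union> null_sets M)"


section \<open>Square-integrable adapted processes and the Ito integral\<close>

definition time_product :: "'a measure \<Rightarrow> real \<Rightarrow> (real \<times> 'a) measure" where
  "time_product M t = restrict_space lborel {0..t} \<Otimes>\<^sub>M M"

definition adapted :: "(real \<Rightarrow> 'a measure) \<Rightarrow> real \<Rightarrow> (real \<Rightarrow> 'a \<Rightarrow> real) \<Rightarrow> bool" where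
  "adapted F t v \<longleftrightarrow> (\<forall>s\<in>{0..t}. v s \<in> borel_measurable (F s))"

text \<open>The space \<open>M\<^sup>2(0,t;\<real>)\<close>; a vector-valued process lies in \<open>M\<^sup>2\<close> iff its components do.\<close>

definition in_M2 ::
    "'a measure \<Rightarrow> (real \<Rightarrow> 'a measure) \<Rightarrow> real \<Rightarrow> (real \<Rightarrow> 'a \<Rightarrow> real) \<Rightarrow> bool" where
  "in_M2 M F t v \<longleftrightarrow> adapted F t v
     \<and> (\<lambda>(s, \<omega>). v s \<omega>) \<in> borel_measurable (time_product M t)
     \<and> integrable (time_product M t) (\<lambda>(s, \<omega>). (v s \<omega>)\<^sup>2)"

text \<open>\<open>\<phi>\<close> is a simple process on \<open>[0,t]\<close> and \<open>J\<close> is its elementary stochastic integral.\<close>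

definition simple_ito_integral ::
    "(real \<Rightarrow> 'a measure) \<Rightarrow> (real \<Rightarrow> 'a \<Rightarrow> real) \<Rightarrow> real
      \<Rightarrow> (real \<Rightarrow> 'a \<Rightarrow> real) \<Rightarrow> ('a \<Rightarrow> real) \<Rightarrow> bool" where
  "simple_ito_integral F B t \<phi> J \<longleftrightarrow>
     (\<exists>(n :: nat) (s :: nat \<Rightarrow> real) (\<xi> :: nat \<Rightarrow> 'a \<Rightarrow> real).
        0 \<le> s 0 \<and> s n \<le> t \<and> (\<forall>i<n. s i \<le> s (Suc i))
      \<and> (\<forall>i<n. \<xi> i \<in> borel_measurable (F (s i)))
      \<and> (\<forall>i<n. \<exists>C. \<forall>\<omega>\<in>space (F (s i)). \<bar>\<xi> i \<omega>\<bar> \<le> C)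
      \<and> \<phi> = (\<lambda>r \<omega>. \<Sum>i<n. \<xi> i \<omega> * indicator {s i<..s (Suc i)} r)
      \<and> J = (\<lambda>\<omega>. \<Sum>i<n. \<xi> i \<omega> * (B (s (Suc i)) \<omega> - B (s i) \<omega>)))"

text \<open>\<open>I\<close> is (a version of) \<open>\<integral>\<^sub>0\<^sup>t v\<^sub>s dB\<^sub>s\<close>, the \<open>L\<^sup>2\<close>-limit of
  the elementary integrals of simple processes converging to \<open>v\<close> in \<open>L\<^sup>2([0,t] \<times> \<Omega>)\<close>.\<close>

definition has_ito_integral ::
    "'a measure \<Rightarrow> (real \<Rightarrow> 'a measure) \<Rightarrow> (real \<Rightarrow> 'a \<Rightarrow> real) \<Rightarrow> real
      \<Rightarrow> (real \<Rightarrow> 'a \<Rightarrow> real) \<Rightarrow> ('a \<Rightarrow> real) \<Rightarrow> bool" where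
  "has_ito_integral M F B t v I \<longleftrightarrow>
     in_M2 M F t v \<and> I \<in> borel_measurable M \<and>
     (\<exists>\<phi> J. (\<forall>j::nat. simple_ito_integral F B t (\<phi> j) (J j))
        \<and> (\<lambda>j. \<integral>\<^sup>+ (s, \<omega>). ennreal ((\<phi> j s \<omega> - v s \<omega>)\<^sup>2) \<partial>time_product M t) \<longlonglongrightarrow> 0
        \<and> (\<lambda>j. \<integral>\<^sup>+ \<omega>. ennreal ((J j \<omega> - I \<omega>)\<^sup>2) \<partial>M) \<longlonglongrightarrow> 0)"

text \<open>The differential relation \<open>dX\<^sub>t = b\<^sub>t dt + \<sigma>\<^sub>t dB\<^sub>t\<close> on \<open>[0,T]\<close>.\<close>

definition has_ito_differential ::
    "'a measure \<Rightarrow> (real \<Rightarrow> 'a measure) \<Rightarrow> (real \<Rightarrow> 'a \<Rightarrow> real) \<Rightarrow> real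
      \<Rightarrow> (real \<Rightarrow> 'a \<Rightarrow> real) \<Rightarrow> (real \<Rightarrow> 'a \<Rightarrow> real) \<Rightarrow> (real \<Rightarrow> 'a \<Rightarrow> real) \<Rightarrow> bool" where
  "has_ito_differential M F B T X b \<sigma> \<longleftrightarrow>
     (AE \<omega> in M. continuous_on {0..T} (\<lambda>t. X t \<omega>))
   \<and> (\<forall>t\<in>{0..T}. \<exists>I. has_ito_integral M F B t \<sigma> I
        \<and> (AE \<omega> in M. set_integrable lborel {0..t} (\<lambda>s. b s \<omega>)
             \<and> X t \<omega> = X 0 \<omega> + (LINT s:{0..t}|lborel. b s \<omega>) + I \<omega>))"


section \<open>Standing assumptions and the eigenvalue problem\<close>

definition monotonicity :: "real \<Rightarrow> real^3^3 \<Rightarrow> bool" where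
  "monotonicity \<beta> A \<longleftrightarrow>
     (\<forall>v :: real^3. v \<bullet> ((\<chi> i j. if i = 1 then - A $ i $ j else A $ i $ j) *v v)
        \<le> - \<beta> * (v \<bullet> v))"

definition standing_assumptions ::
    "real \<Rightarrow> (real \<Rightarrow> real^3^3) \<Rightarrow> (real \<Rightarrow> real) \<Rightarrow> bool" where
  "standing_assumptions T H h22 \<longleftrightarrow>
     continuous_on {0..T} H
   \<and> (\<forall>t\<in>{0..T}. transpose (H t) = H t)
   \<and> (\<exists>\<beta>>0. \<forall>t\<in>{0..T}. monotonicity \<beta> (H t))
   \<and> (\<forall>t\<in>{0..T}. H t $ 2 $ 3 = - H t $ 3 $ 3 * H t $ 1 $ 3)
   \<and> continuous_on {0..T} h22
   \<and> (\<forall>t\<in>{0..T}. h22 t < 0)"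

definition problem_E_solution ::
    "'a measure \<Rightarrow> (real \<Rightarrow> 'a \<Rightarrow> real) \<Rightarrow> real \<Rightarrow> (real \<Rightarrow> real^3^3) \<Rightarrow> (real \<Rightarrow> real) \<Rightarrow> real
      \<Rightarrow> (real \<Rightarrow> 'a \<Rightarrow> real) \<Rightarrow> (real \<Rightarrow> 'a \<Rightarrow> real) \<Rightarrow> (real \<Rightarrow> 'a \<Rightarrow> real) \<Rightarrow> bool" where
  "problem_E_solution M B T H h22 lam x y z \<longleftrightarrow>
     (let F = augmented_filtration M B in
        in_M2 M F T x \<and> in_M2 M F T y \<and> in_M2 M F T z
      \<and> has_ito_differential M F B T x
          (\<lambda>t \<omega>. H t $ 2 $ 1 * x t \<omega> + (H t $ 2 $ 2 - lam * h22 t) * y t \<omega> + H t $ 2 $ 3 * z t \<omega>)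
          (\<lambda>t \<omega>. H t $ 3 $ 1 * x t \<omega> + H t $ 3 $ 2 * y t \<omega> + H t $ 3 $ 3 * z t \<omega>)
      \<and> has_ito_differential M F B T y
          (\<lambda>t \<omega>. - (H t $ 1 $ 1 * x t \<omega> + H t $ 1 $ 2 * y t \<omega> + H t $ 1 $ 3 * z t \<omega>))
          z
      \<and> (AE \<omega> in M. x 0 \<omega> = 0)
      \<and> (AE \<omega> in M. y T \<omega> = 0))"

definition is_eigenvalue ::
    "'a measure \<Rightarrow> (real \<Rightarrow> 'a \<Rightarrow> real) \<Rightarrow> real \<Rightarrow> (real \<Rightarrow> real^3^3) \<Rightarrow> (real \<Rightarrow> real) \<Rightarrow> real \<Rightarrow> bool"
    where
  "is_eigenvalue M B T H h22 lam \<longleftrightarrow>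
     (\<exists>x y z. problem_E_solution M B T H h22 lam x y z
        \<and> \<not> (AE (t, \<omega>) in time_product M T. x t \<omega> = 0 \<and> y t \<omega> = 0 \<and> z t \<omega> = 0))"

definition lambda_b :: "real \<Rightarrow> (real \<Rightarrow> real^3^3) \<Rightarrow> (real \<Rightarrow> real) \<Rightarrow> real" where
  "lambda_b T H h22 =
     (INF t\<in>{0..T}. H t $ 2 $ 2 - H t $ 3 $ 3 * (H t $ 1 $ 3)\<^sup>2) / (SUP t\<in>{0..T}. h22 t)"


section \<open>Riccati equations, explosion times and statistic period\<close>

definition extend_left :: "(real \<Rightarrow> 'b) \<Rightarrow> real \<Rightarrow> 'b" where
  "extend_left f t = f (max 0 t)"

text \<open>\<open>k\<close> solves \<open>- dk/dt = g t k\<close>, \<open>k(b) = 0\<close> on the interval \<open>(a, b]\<close>; values of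
  \<open>k\<close> outside this interval are irrelevant.\<close>

definition backward_solution ::
    "(real \<Rightarrow> real \<Rightarrow> real) \<Rightarrow> real \<Rightarrow> ereal \<Rightarrow> (real \<Rightarrow> real) \<Rightarrow> bool" where
  "backward_solution g b a k \<longleftrightarrow> a < ereal b \<and> k b = 0 \<and>
     (\<forall>t. a < ereal t \<and> t \<le> b \<longrightarrow>
        (k has_real_derivative - g t (k t)) (at t within {s. a < ereal s \<and> s \<le> b}))"

definition maximal_backward_solution ::
    "(real \<Rightarrow> real \<Rightarrow> real) \<Rightarrow> real \<Rightarrow> ereal \<Rightarrow> (real \<Rightarrow> real) \<Rightarrow> bool" where
  "maximal_backward_solution g b a k \<longleftrightarrow> backward_solution g b a k \<and>
     (\<forall>a' k'. backward_solution g b a' k' \<and> a' \<le> a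
        \<and> (\<forall>t. a < ereal t \<and> t \<le> b \<longrightarrow> k' t = k t) \<longrightarrow> a' = a)"

text \<open>The filter \<open>L\<close> is \<open>at_top\<close> or \<open>at_bot\<close>. The supremum is taken in the
  extended reals, where \<open>Sup {} = -\<infinity>\<close>.\<close>

definition explosion_time ::
    "(real \<Rightarrow> real \<Rightarrow> real) \<Rightarrow> real filter \<Rightarrow> real \<Rightarrow> ereal" where
  "explosion_time g L b =
     Sup {ereal t0 | t0. t0 < b \<and>
       (\<exists>a k. maximal_backward_solution g b a k \<and> a \<le> ereal t0
          \<and> filterlim k L (at_right t0))}"

definition riccati :: "(real \<Rightarrow> real^3^3) \<Rightarrow> (real \<Rightarrow> real) \<Rightarrow> real \<Rightarrow> real \<Rightarrow> real \<Rightarrow> real" where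
  "riccati H h22 lam t k =
     (let G = extend_left H t; h = extend_left h22 t in
       (2 * G $ 2 $ 1 + (G $ 1 $ 3)\<^sup>2) * k + G $ 1 $ 1
       + (G $ 2 $ 2 - G $ 3 $ 3 * (G $ 1 $ 3)\<^sup>2 - lam * h) * k\<^sup>2)"

definition dual_riccati :: "(real \<Rightarrow> real^3^3) \<Rightarrow> (real \<Rightarrow> real) \<Rightarrow> real \<Rightarrow> real \<Rightarrow> real \<Rightarrow> real" where
  "dual_riccati H h22 lam t k =
     (let G = extend_left H t; h = extend_left h22 t in
       - (2 * G $ 2 $ 1 + (G $ 1 $ 3)\<^sup>2) * k - G $ 1 $ 1 * k\<^sup>2
       - (G $ 2 $ 2 - G $ 3 $ 3 * (G $ 1 $ 3)\<^sup>2 - lam * h))"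

primrec switching_time ::
    "real \<Rightarrow> (real \<Rightarrow> real^3^3) \<Rightarrow> (real \<Rightarrow> real) \<Rightarrow> real \<Rightarrow> nat \<Rightarrow> ereal" where
  "switching_time T H h22 lam 0 = ereal T"
| "switching_time T H h22 lam (Suc n) =
     (if switching_time T H h22 lam n = -\<infinity> then -\<infinity>
      else if even n
        then explosion_time (riccati H h22 lam) at_top (real_of_ereal (switching_time T H h22 lam n))
        else explosion_time (dual_riccati H h22 lam) at_bot (real_of_ereal (switching_time T H h22 lam n)))"

text \<open>For an eigenvalue \<open>lam > lambda_b T H h22\<close> this relation says that \<open>m\<close> is the statistic period of
  its eigenfunctions; equivalently, that \<open>lam\<close> is the eigenvalue indexed by \<open>m\<close>.\<close>

definition has_statistic_period ::
    "real \<Rightarrow> (real \<Rightarrow> real^3^3) \<Rightarrow> (real \<Rightarrow> real) \<Rightarrow> real \<Rightarrow> nat \<Rightarrow> bool" where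
  "has_statistic_period T H h22 lam m \<longleftrightarrow>
     0 < m \<and> switching_time T H h22 lam (2 * m - 1) = 0"

definition eigenvalue_with_index ::
    "'a measure \<Rightarrow> (real \<Rightarrow> 'a \<Rightarrow> real) \<Rightarrow> real \<Rightarrow> (real \<Rightarrow> real^3^3) \<Rightarrow> (real \<Rightarrow> real)
      \<Rightarrow> nat \<Rightarrow> real \<Rightarrow> bool" where
  "eigenvalue_with_index M B T H h22 m lam \<longleftrightarrow>
     is_eigenvalue M B T H h22 lam \<and> lambda_b T H h22 < lam \<and> has_statistic_period T H h22 lam m"

end

theory Submission
  imports Defs
begin

text \<open>
  The bounds come from the speed of a rotation. Put
  \<open>p = H\<^sub>1\<^sub>1\<close>, \<open>q = 2H\<^sub>2\<^sub>1 + H\<^sub>1\<^sub>3\<^sup>2\<close> and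
  \<open>r = H\<^sub>2\<^sub>2 - H\<^sub>3\<^sub>3H\<^sub>1\<^sub>3\<^sup>2 - \<lambda>h\<^sub>2\<^sub>2\<close>, so that
  \<open>- k' = p + q k + r k\<^sup>2\<close>. Along a solution that vanishes at \<open>b\<close> and explodes
  at \<open>t\<^sub>0 < b\<close>, the angle \<open>arctan (k/s)\<close> makes a quarter turn backward from \<open>b\<close>
  to \<open>t\<^sub>0\<close>, for every scale \<open>s > 0\<close>. The dual equation is the equation of \<open>1/k\<close>;
  up to a sign it is again a Riccati equation, with \<open>p\<close> and \<open>r\<close> interchanged and \<open>q\<close> negated, and
  its angle at the scale \<open>1/s\<close> continues the same rotation. Statistic period \<open>m\<close> therefore means
  that exactly \<open>2m - 1\<close> quarter turns fill the time interval \<open>[0,T]\<close>.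

  The speed of the angle is \<open>s(p + q k + r k\<^sup>2)/(s\<^sup>2 + k\<^sup>2)\<close>. If constants \<open>A\<close> and \<open>C\<close>
  bound \<open>p\<close> and \<open>r\<close> from one side, the scale \<open>s = sqrt (A/C)\<close> makes the contributions of
  \<open>p\<close> and \<open>r\<close> combine to the constant speed \<open>sqrt (A C)\<close>, while \<open>q\<close> contributes at most
  \<open>sup |q| / 2\<close> in absolute value (\<open>period_upper_speed\<close>, \<open>period_lower_speed\<close>). Since \<open>C\<close> is
  affine in \<open>\<lambda>\<close>, this says \<open>\<lambda> \<approx> m\<^sup>2\<pi>\<^sup>2 / (H\<^sub>1\<^sub>1|h\<^sub>2\<^sub>2|T\<^sup>2)\<close>, up to errors of lower
  order in \<open>m\<close> and the variation of the coefficients.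
  The bounds of the theorem leave a factor \<open>4\<close> above and \<open>1/2\<close> below, and this room
  absorbs the errors once \<open>m\<close> is large. The claim on the statistic period is the
  contrapositive: both bounds increase with \<open>m\<close>, and the upper one is derived from an inequality that
  holds for every period, including small ones.
\<close>

section \<open>The rotation angle of a Riccati equation\<close>

text \<open>The inequality \<open>2 s |k| \<le> s\<^sup>2 + k\<^sup>2\<close> turns the linear term into half of \<open>Q\<close>. The
  remaining two hypotheses say that the scale \<open>s\<close> balances the constant and the quadratic term.
  Since \<open>w\<close> may be negative, this also gives bounds of the opposite kind after a change of sign.\<close>

lemma quadratic_rate_bound:
  fixes s w q Q \<alpha> \<gamma> k :: real
  assumes "0 < s" "\<alpha> \<le> w * s" "s * \<gamma> \<le> w" "\<bar>q\<bar> \<le> Q"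
  shows "s * (q * k + \<alpha> + \<gamma> * k\<^sup>2) \<le> (w + Q / 2) * (s\<^sup>2 + k\<^sup>2)"
proof -
  have 1: "s * \<alpha> \<le> w * s\<^sup>2"
    using mult_left_mono[OF assms(2), of s] assms(1) by (simp add: power2_eq_square algebra_simps)
  have 2: "s * \<gamma> * k\<^sup>2 \<le> w * k\<^sup>2"
    using mult_right_mono[OF assms(3), of "k\<^sup>2"] by simp
  have "0 \<le> (s - \<bar>k\<bar>)\<^sup>2" by simp
  then have amgm: "s * \<bar>k\<bar> \<le> (s\<^sup>2 + k\<^sup>2) / 2"
    by (simp add: power2_diff)
  have "q * (s * k) \<le> \<bar>q\<bar> * (s * \<bar>k\<bar>)"
    using assms(1) by (metis abs_ge_self abs_mult abs_of_pos)
  also have "\<dots> \<le> Q * ((s\<^sup>2 + k\<^sup>2) / 2)"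
    using assms(1,4) amgm by (intro mult_mono) auto
  finally show ?thesis using 1 2 by (simp add: algebra_simps)
qed

lemma arctan_blow_up_at_right:
  fixes k :: "real \<Rightarrow> real"
  assumes "0 < s" "filterlim k at_top (at_right t0)"
  shows "((\<lambda>t. arctan (k t / s)) \<longlongrightarrow> pi / 2) (at_right t0)"
proof (rule filterlim_compose[OF tendsto_arctan_at_top])
  show "filterlim (\<lambda>t. k t / s) at_top (at_right t0)"
    using filterlim_tendsto_pos_mult_at_top[OF tendsto_const[of "1 / s"] _ assms(2)] assms(1)
    by simp
qed

text \<open>The mean value theorem for the angle \<open>arctan (k/s)\<close>, whose derivative is
  \<open>- s g / (s\<^sup>2 + k\<^sup>2)\<close> and which vanishes at \<open>b\<close>.\<close>

lemma backward_solution_angle_mvt: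
  assumes sol: "backward_solution g b a k" and s: "0 < s" and t: "a < ereal t" "t < b"
  shows "\<exists>\<xi>\<le>b. arctan (k t / s) * (s\<^sup>2 + (k \<xi>)\<^sup>2) = (b - t) * (s * g \<xi> (k \<xi>))"
proof -
  have kb: "k b = 0" using sol by (simp add: backward_solution_def)
  have der: "((\<lambda>t. arctan (k t / s)) has_real_derivative
      - (s * g u (k u)) / (s\<^sup>2 + (k u)\<^sup>2)) (at u within {t..b})"
    if u: "u \<in> {t..b}" for u
  proof -
    have au: "a < ereal v" if "t \<le> v" for v
      using t(1) that by (meson ereal_less_eq(3) less_le_trans)
    have "(k has_real_derivative - g u (k u)) (at u within {s. a < ereal s \<and> s \<le> b})"
      using sol u au by (auto simp: backward_solution_def)
    then have "(k has_real_derivative - g u (k u)) (at u within {t..b})"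
      by (rule DERIV_subset) (use au in auto)
    then have "((\<lambda>t. arctan (k t / s)) has_real_derivative
        inverse (1 + (k u / s)\<^sup>2) * (- g u (k u) / s)) (at u within {t..b})"
      by (rule DERIV_chain2[OF DERIV_arctan DERIV_cdivide])
    moreover have "inverse (1 + (k u / s)\<^sup>2) * (- g u (k u) / s) =
        - (s * g u (k u)) / (s\<^sup>2 + (k u)\<^sup>2)"
    proof -
      have "s\<^sup>2 + (k u)\<^sup>2 > 0" using s by (simp add: sum_power2_gt_zero_iff)
      moreover have "1 + (k u / s)\<^sup>2 = (s\<^sup>2 + (k u)\<^sup>2) / s\<^sup>2"
        using s by (simp add: field_simps)
      ultimately show ?thesis using s by (simp add: power2_eq_square)
    qed
    ultimately show ?thesis by simp
  qed
  obtain \<xi> where \<xi>: "t < \<xi>" "\<xi> < b"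
    "arctan (k b / s) - arctan (k t / s) = - (s * g \<xi> (k \<xi>)) / (s\<^sup>2 + (k \<xi>)\<^sup>2) * (b - t)"
  proof -
    have "\<exists>\<xi>\<in>{t<..<b}. arctan (k b / s) - arctan (k t / s) =
        - (s * g \<xi> (k \<xi>)) / (s\<^sup>2 + (k \<xi>)\<^sup>2) * (b - t)"
      by (rule mvt_simple[OF t(2)])
        (rule der[unfolded has_field_derivative_def], simp)
    then show ?thesis using that by auto
  qed
  moreover have "s\<^sup>2 + (k \<xi>)\<^sup>2 > 0" using s by (simp add: sum_power2_gt_zero_iff)
  moreover have "arctan (k t / s) = s * g \<xi> (k \<xi>) / (s\<^sup>2 + (k \<xi>)\<^sup>2) * (b - t)"
    using \<xi>(3) kb by simp
  ultimately have "arctan (k t / s) * (s\<^sup>2 + (k \<xi>)\<^sup>2) = (b - t) * (s * g \<xi> (k \<xi>))"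
    by simp
  with \<xi>(2) show ?thesis by (meson less_imp_le)
qed

text \<open>The sign \<open>\<epsilon>\<close> serves both estimates at once: with \<open>\<epsilon> = 1\<close> an upper bound on
  the angular speed makes a quarter turn take long, with \<open>\<epsilon> = - 1\<close> a lower bound makes it
  short.\<close>

lemma quarter_turn_duration:
  assumes sol: "backward_solution g b (ereal t0) k" and s: "0 < s"
    and lim: "filterlim k at_top (at_right t0)"
    and rate: "\<And>t x. t \<le> b \<Longrightarrow> \<epsilon> * (s * g t x) \<le> R * (s\<^sup>2 + x\<^sup>2)"
  shows "\<epsilon> * (pi / 2) \<le> R * (b - t0)"
proof -
  have b: "t0 < b" using sol by (simp add: backward_solution_def)
  have bound: "\<epsilon> * arctan (k t / s) \<le> R * (b - t)" if t: "t0 < t" "t < b" for t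
  proof -
    obtain \<xi> where \<xi>: "\<xi> \<le> b"
        "arctan (k t / s) * (s\<^sup>2 + (k \<xi>)\<^sup>2) = (b - t) * (s * g \<xi> (k \<xi>))"
      using backward_solution_angle_mvt[OF sol s] t by auto
    have "\<epsilon> * arctan (k t / s) * (s\<^sup>2 + (k \<xi>)\<^sup>2) = (b - t) * (\<epsilon> * (s * g \<xi> (k \<xi>)))"
      using \<xi>(2) by (metis mult.assoc mult.left_commute)
    also have "\<dots> \<le> (b - t) * (R * (s\<^sup>2 + (k \<xi>)\<^sup>2))"
      using rate \<xi>(1) t by (intro mult_left_mono) auto
    finally have "\<epsilon> * arctan (k t / s) * (s\<^sup>2 + (k \<xi>)\<^sup>2) \<le> (R * (b - t)) * (s\<^sup>2 + (k \<xi>)\<^sup>2)"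
      by (simp add: algebra_simps)
    moreover have "s\<^sup>2 + (k \<xi>)\<^sup>2 > 0" using s by (simp add: sum_power2_gt_zero_iff)
    ultimately show ?thesis by simp
  qed
  show ?thesis
  proof (rule tendsto_le[of "at_right t0"])
    show "((\<lambda>t. R * (b - t)) \<longlongrightarrow> R * (b - t0)) (at_right t0)"
      by (intro tendsto_intros)
    show "((\<lambda>t. \<epsilon> * arctan (k t / s)) \<longlongrightarrow> \<epsilon> * (pi / 2)) (at_right t0)"
      by (intro tendsto_mult tendsto_const arctan_blow_up_at_right[OF s lim])
    show "\<forall>\<^sub>F t in at_right t0. \<epsilon> * arctan (k t / s) \<le> R * (b - t)"
      using bound b by (auto simp: eventually_at_right_field)
  qed simp
qed

text \<open>This reduces solutions that explode to \<open>-\<infinity>\<close> to solutions that explode to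
  \<open>+\<infinity>\<close>.\<close>

lemma backward_solution_uminus:
  assumes "backward_solution g b a k"
  shows "backward_solution (\<lambda>t x. - g t (- x)) b a (\<lambda>t. - k t)"
  using assms unfolding backward_solution_def
  by (auto intro!: derivative_eq_intros)

section \<open>Accumulated rotation at the switching times\<close>

text \<open>A solution is continuous wherever it is defined, so it can only explode at the left end of
  its interval.\<close>

lemma blow_up_at_left_end:
  assumes sol: "backward_solution g b a k" and "a \<le> ereal t0" "t0 < b"
    and lim: "filterlim k at_infinity (at_right t0)"
  shows "a = ereal t0"
proof (rule ccontr)
  assume "a \<noteq> ereal t0"
  then have a: "a < ereal t0" using assms(2) by simp
  have av: "a < ereal v" if "t0 \<le> v" for v
    using a that by (meson ereal_less_eq(3) less_le_trans)
  have "(k has_real_derivative - g t0 (k t0)) (at t0 within {s. a < ereal s \<and> s \<le> b})"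
    using sol a assms(3) by (auto simp: backward_solution_def)
  then have "(k has_real_derivative - g t0 (k t0)) (at t0 within {t0..b})"
    by (rule DERIV_subset) (use av in auto)
  then have "(k \<longlongrightarrow> k t0) (at t0 within {t0..b})"
    by (metis DERIV_continuous continuous_within)
  then have "(k \<longlongrightarrow> k t0) (at_right t0)"
    using at_within_Icc_at_right[OF assms(3)] by simp
  then show False
    using lim not_tendsto_and_filterlim_at_infinity trivial_limit_at_right_real by blast
qed

text \<open>The explosion time is a supremum over blow-up times, so it inherits every closed condition
  that all of them satisfy.\<close>

lemma explosion_time_in_closed:
  assumes L: "L \<le> at_infinity" and fin: "explosion_time g L b \<noteq> -\<infinity>"
    and P: "closed P"
    and legs: "\<And>t0 k. backward_solution g b (ereal t0) k \<Longrightarrow> filterlim k L (at_right t0) \<Longrightarrow> t0 \<in> P"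
  shows "\<exists>\<tau>\<in>P. \<tau> \<le> b \<and> explosion_time g L b = ereal \<tau>"
proof -
  define S where "S = {t0. t0 < b \<and> (\<exists>a k. maximal_backward_solution g b a k \<and> a \<le> ereal t0
          \<and> filterlim k L (at_right t0))}"
  have E: "explosion_time g L b = Sup (ereal ` S)"
    unfolding explosion_time_def S_def by (simp add: image_Collect)
  have "S \<subseteq> P"
  proof
    fix t0 assume "t0 \<in> S"
    then obtain a k where ak: "t0 < b" "backward_solution g b a k" "a \<le> ereal t0"
        "filterlim k L (at_right t0)"
      by (auto simp: S_def maximal_backward_solution_def)
    have "a = ereal t0"
      using blow_up_at_left_end ak filterlim_mono[OF ak(4) L order_refl] by blast
    then show "t0 \<in> P" using legs ak by blast
  qed
  have ne: "S \<noteq> {}" using fin E by (auto simp: bot_ereal_def)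
  have le: "t0 \<le> b" if "t0 \<in> S" for t0 using that by (auto simp: S_def)
  then have bdd: "bdd_above S" by (rule bdd_aboveI)
  have "Sup (ereal ` S) \<le> ereal b" using le by (intro Sup_least) auto
  then have "\<bar>Sup (ereal ` S)\<bar> \<noteq> \<infinity>" using fin E by auto
  then have "explosion_time g L b = ereal (Sup S)" using E by (simp add: ereal_Sup)
  moreover have "Sup S \<in> P"
    using closure_contains_Sup[OF ne bdd] closure_minimal[OF \<open>S \<subseteq> P\<close> P] by blast
  moreover have "Sup S \<le> b" using ne le by (rule cSup_least)
  ultimately show ?thesis by blast
qed

text \<open>The legs alternate between the Riccati equation, seen at the scale \<open>s\<close>, and the dual
  equation, seen at the scale \<open>1/s\<close>; each contributes one quarter turn.\<close>

lemma switching_time_rotation: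
  assumes "switching_time T H h lam n \<noteq> -\<infinity>" and s: "0 < s"
    and primal: "\<And>t x. t \<le> T \<Longrightarrow> \<epsilon> * (s * riccati H h lam t x) \<le> R * (s\<^sup>2 + x\<^sup>2)"
    and dual: "\<And>t x. t \<le> T \<Longrightarrow>
      \<epsilon> * ((1 / s) * - dual_riccati H h lam t (- x)) \<le> R * ((1 / s)\<^sup>2 + x\<^sup>2)"
  shows "\<exists>\<tau>\<le>T. switching_time T H h lam n = ereal \<tau> \<and> \<epsilon> * (real n * (pi / 2)) \<le> R * (T - \<tau>)"
  using assms(1)
proof (induction n)
  case 0
  then show ?case by simp
next
  case (Suc n)
  define g where "g = (if even n then riccati H h lam else dual_riccati H h lam)"
  define L :: "real filter" where "L = (if even n then at_top else at_bot)"
  obtain \<tau> where \<tau>: "switching_time T H h lam n = ereal \<tau>" "\<tau> \<le> T"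
      "\<epsilon> * (real n * (pi / 2)) \<le> R * (T - \<tau>)"
    using Suc by (auto split: if_splits)
  have E: "switching_time T H h lam (Suc n) = explosion_time g L \<tau>"
    using \<tau>(1) by (simp add: g_def L_def)
  have "\<exists>\<tau>'\<in>{\<tau>'. \<epsilon> * (pi / 2) \<le> R * (\<tau> - \<tau>')}. \<tau>' \<le> \<tau> \<and> explosion_time g L \<tau> = ereal \<tau>'"
  proof (rule explosion_time_in_closed)
    show "L \<le> at_infinity"
      by (simp add: L_def at_top_le_at_infinity at_bot_le_at_infinity)
    show "explosion_time g L \<tau> \<noteq> -\<infinity>" using Suc.prems E by metis
    show "closed {\<tau>'. \<epsilon> * (pi / 2) \<le> R * (\<tau> - \<tau>')}"
      by (intro closed_Collect_le continuous_intros)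
    fix t0 k assume k: "backward_solution g \<tau> (ereal t0) k" "filterlim k L (at_right t0)"
    have "\<epsilon> * (pi / 2) \<le> R * (\<tau> - t0)"
    proof (cases "even n")
      case True
      then show ?thesis
        using k \<tau>(2) primal quarter_turn_duration[OF _ s, of g \<tau> t0 k \<epsilon> R]
        by (simp add: g_def L_def)
    next
      case False
      have s': "0 < 1 / s" using s by simp
      have "backward_solution (\<lambda>t x. - dual_riccati H h lam t (- x)) \<tau> (ereal t0) (\<lambda>t. - k t)"
        using backward_solution_uminus[OF k(1)] False by (simp add: g_def)
      moreover have "filterlim (\<lambda>t. - k t) at_top (at_right t0)"
        using k(2) False by (simp add: L_def filterlim_uminus_at_top)
      ultimately show ?thesis
        using quarter_turn_duration[OF _ s', of _ \<tau> t0 "\<lambda>t. - k t" \<epsilon> R] dual \<tau>(2)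
        by simp
    qed
    then show "t0 \<in> {\<tau>'. \<epsilon> * (pi / 2) \<le> R * (\<tau> - \<tau>')}" by simp
  qed
  then obtain \<tau>' where \<tau>': "explosion_time g L \<tau> = ereal \<tau>'" "\<tau>' \<le> \<tau>"
      "\<epsilon> * (pi / 2) \<le> R * (\<tau> - \<tau>')" by blast
  have "\<epsilon> * (real (Suc n) * (pi / 2)) \<le> R * (T - \<tau>')"
    using \<tau>(3) \<tau>'(3) by (simp add: algebra_simps add_divide_distrib)
  then show ?case
    using E \<tau>'(1,2) \<tau>(2) by (metis order_trans)
qed

text \<open>Passing to the dual equation exchanges the constant and the quadratic coefficient, and the
  scale \<open>1/s\<close> exchanges their bounds accordingly, so both kinds of legs have the same
  bound on their speed.\<close>

lemma statistic_period_rotation: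
  fixes H :: "real \<Rightarrow> real^3^3"
  assumes T: "0 \<le> T" and s: "0 < s" and \<epsilon>: "\<bar>\<epsilon>\<bar> \<le> 1"
    and q: "\<And>t. t \<in> {0..T} \<Longrightarrow> \<bar>2 * H t $ 2 $ 1 + (H t $ 1 $ 3)\<^sup>2\<bar> \<le> Q"
    and p: "\<And>t. t \<in> {0..T} \<Longrightarrow> \<epsilon> * H t $ 1 $ 1 \<le> w * s"
    and r: "\<And>t. t \<in> {0..T} \<Longrightarrow>
      s * (\<epsilon> * (H t $ 2 $ 2 - H t $ 3 $ 3 * (H t $ 1 $ 3)\<^sup>2 - lam * h t)) \<le> w"
    and per: "has_statistic_period T H h lam m"
  shows "\<epsilon> * (pi * real m - pi / 2) \<le> (w + Q / 2) * T"
proof -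
  have m: "0 < m" "switching_time T H h lam (2 * m - 1) = 0"
    using per by (auto simp: has_statistic_period_def)
  have *: "\<bar>\<epsilon> * x\<bar> \<le> Q" if "\<bar>x\<bar> \<le> Q" for x
    using mult_mono[OF \<epsilon> that] by (simp add: abs_mult)
  have "\<exists>\<tau>\<le>T. switching_time T H h lam (2 * m - 1) = ereal \<tau> \<and>
      \<epsilon> * (real (2 * m - 1) * (pi / 2)) \<le> (w + Q / 2) * (T - \<tau>)"
  proof (rule switching_time_rotation[OF _ s])
    show "switching_time T H h lam (2 * m - 1) \<noteq> -\<infinity>" using m by simp
    fix t x assume "t \<le> T"
    then have t: "max 0 t \<in> {0..T}" using T by auto
    let ?H = "H (max 0 t)"
    let ?q = "2 * ?H $ 2 $ 1 + (?H $ 1 $ 3)\<^sup>2"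
    let ?r = "?H $ 2 $ 2 - ?H $ 3 $ 3 * (?H $ 1 $ 3)\<^sup>2 - lam * h (max 0 t)"
    have "s * ((\<epsilon> * ?q) * x + \<epsilon> * ?H $ 1 $ 1 + (\<epsilon> * ?r) * x\<^sup>2) \<le> (w + Q / 2) * (s\<^sup>2 + x\<^sup>2)"
      by (rule quadratic_rate_bound[OF s p[OF t] r[OF t] *[OF q[OF t]]])
    moreover have "\<epsilon> * (s * riccati H h lam t x) =
        s * ((\<epsilon> * ?q) * x + \<epsilon> * ?H $ 1 $ 1 + (\<epsilon> * ?r) * x\<^sup>2)"
      by (simp add: riccati_def extend_left_def Let_def algebra_simps)
    ultimately show "\<epsilon> * (s * riccati H h lam t x) \<le> (w + Q / 2) * (s\<^sup>2 + x\<^sup>2)"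
      by (simp only:)
    have q': "\<bar>\<epsilon> * - ?q\<bar> \<le> Q"
      by (rule *) (use q[OF t] in \<open>simp only: abs_minus_cancel\<close>)
    have "1 / s * ((\<epsilon> * - ?q) * x + \<epsilon> * ?r + (\<epsilon> * ?H $ 1 $ 1) * x\<^sup>2)
        \<le> (w + Q / 2) * ((1 / s)\<^sup>2 + x\<^sup>2)"
      by (rule quadratic_rate_bound[OF _ _ _ q'])
        (use s p[OF t] r[OF t] in \<open>simp_all add: field_simps\<close>)
    moreover have "\<epsilon> * ((1 / s) * - dual_riccati H h lam t (- x)) =
        1 / s * ((\<epsilon> * - ?q) * x + \<epsilon> * ?r + (\<epsilon> * ?H $ 1 $ 1) * x\<^sup>2)"
      by (simp add: dual_riccati_def extend_left_def Let_def algebra_simps)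
    ultimately show "\<epsilon> * ((1 / s) * - dual_riccati H h lam t (- x))
        \<le> (w + Q / 2) * ((1 / s)\<^sup>2 + x\<^sup>2)"
      by (simp only:)
  qed
  then have "\<epsilon> * (real (2 * m - 1) * (pi / 2)) \<le> (w + Q / 2) * T"
    using m(2) by (auto simp: zero_ereal_def)
  moreover have "real (2 * m - 1) * (pi / 2) = pi * real m - pi / 2"
    using m(1) by (simp add: of_nat_diff field_simps)
  ultimately show ?thesis by (simp only:)
qed

lemma balanced_scale:
  fixes A C :: real
  assumes "0 < A" "0 < C"
  shows "sqrt (A * C) * sqrt (A / C) = A" "sqrt (A / C) * C = sqrt (A * C)"
proof -
  show "sqrt (A * C) * sqrt (A / C) = A"
    using assms by (simp add: real_sqrt_mult real_sqrt_divide)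
  show "sqrt (A / C) * C = sqrt (A * C)"
    using assms by (simp add: real_sqrt_mult real_sqrt_divide field_simps)
qed

lemma period_upper_speed:
  fixes H :: "real \<Rightarrow> real^3^3"
  assumes T: "0 \<le> T" and A: "0 < A" and C: "0 < C"
    and q: "\<And>t. t \<in> {0..T} \<Longrightarrow> \<bar>2 * H t $ 2 $ 1 + (H t $ 1 $ 3)\<^sup>2\<bar> \<le> Q"
    and p: "\<And>t. t \<in> {0..T} \<Longrightarrow> H t $ 1 $ 1 \<le> A"
    and r: "\<And>t. t \<in> {0..T} \<Longrightarrow> H t $ 2 $ 2 - H t $ 3 $ 3 * (H t $ 1 $ 3)\<^sup>2 - lam * h t \<le> C"
    and per: "has_statistic_period T H h lam m"
  shows "pi * real m - pi / 2 \<le> (sqrt (A * C) + Q / 2) * T"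
proof -
  have s: "0 < sqrt (A / C)" using A C by simp
  have "1 * (pi * real m - pi / 2) \<le> (sqrt (A * C) + Q / 2) * T"
  proof (rule statistic_period_rotation[OF T s _ q _ _ per])
    fix t assume t: "t \<in> {0..T}"
    show "1 * H t $ 1 $ 1 \<le> sqrt (A * C) * sqrt (A / C)"
      using p[OF t] balanced_scale(1)[OF A C] by simp
    show "sqrt (A / C) * (1 * (H t $ 2 $ 2 - H t $ 3 $ 3 * (H t $ 1 $ 3)\<^sup>2 - lam * h t))
        \<le> sqrt (A * C)"
      using mult_left_mono[OF r[OF t], of "sqrt (A / C)"] s balanced_scale(2)[OF A C] by simp
  qed simp_all
  then show ?thesis by simp
qed

lemma period_lower_speed:
  fixes H :: "real \<Rightarrow> real^3^3"
  assumes T: "0 \<le> T" and A: "0 < A" and C: "0 < C"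
    and q: "\<And>t. t \<in> {0..T} \<Longrightarrow> \<bar>2 * H t $ 2 $ 1 + (H t $ 1 $ 3)\<^sup>2\<bar> \<le> Q"
    and p: "\<And>t. t \<in> {0..T} \<Longrightarrow> A \<le> H t $ 1 $ 1"
    and r: "\<And>t. t \<in> {0..T} \<Longrightarrow> C \<le> H t $ 2 $ 2 - H t $ 3 $ 3 * (H t $ 1 $ 3)\<^sup>2 - lam * h t"
    and per: "has_statistic_period T H h lam m"
  shows "(sqrt (A * C) - Q / 2) * T \<le> pi * real m - pi / 2"
proof -
  have s: "0 < sqrt (A / C)" using A C by simp
  note eq = balanced_scale[OF A C]
  have "-1 * (pi * real m - pi / 2) \<le> (- sqrt (A * C) + Q / 2) * T"
  proof (rule statistic_period_rotation[OF T s _ q _ _ per])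
    fix t assume t: "t \<in> {0..T}"
    show "-1 * H t $ 1 $ 1 \<le> - sqrt (A * C) * sqrt (A / C)"
      using p[OF t] eq(1) by simp
    show "sqrt (A / C) * (-1 * (H t $ 2 $ 2 - H t $ 3 $ 3 * (H t $ 1 $ 3)\<^sup>2 - lam * h t))
        \<le> - sqrt (A * C)"
      using mult_left_mono[OF r[OF t], of "sqrt (A / C)"] s eq(2) by (simp add: algebra_simps)
  qed simp_all
  then show ?thesis by (simp add: algebra_simps)
qed

section \<open>Bounds for a parameter of given statistic period\<close>

text \<open>If \<open>\<eta> * lam\<close> exceeds \<open>K\<close>, the quadratic coefficient is at least
  \<open>\<eta> * lam - K > 0\<close>, and the rotation is so fast that only a large period can
  accommodate it; otherwise \<open>K\<close> itself is the bound.\<close>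

lemma parameter_upper_bound:
  fixes H :: "real \<Rightarrow> real^3^3"
  assumes T: "0 < T" and a: "0 < a" and \<eta>: "0 < \<eta>" and K: "0 \<le> K"
    and q: "\<And>t. t \<in> {0..T} \<Longrightarrow> \<bar>2 * H t $ 2 $ 1 + (H t $ 1 $ 3)\<^sup>2\<bar> \<le> Q"
    and p: "\<And>t. t \<in> {0..T} \<Longrightarrow> a \<le> H t $ 1 $ 1"
    and D: "\<And>t. t \<in> {0..T} \<Longrightarrow> - K \<le> H t $ 2 $ 2 - H t $ 3 $ 3 * (H t $ 1 $ 3)\<^sup>2"
    and h: "\<And>t. t \<in> {0..T} \<Longrightarrow> h t \<le> - \<eta>"
    and per: "has_statistic_period T H h lam m"
  shows "\<eta> * lam \<le> K + (pi * real m / T + Q / 2)\<^sup>2 / a"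
proof (cases "\<eta> * lam \<le> K")
  case True
  then show ?thesis using a by (simp add: add_increasing2)
next
  case False
  then have lam: "0 < lam" using K \<eta> by (smt (verit) mult_nonneg_nonpos)
  define C where "C = \<eta> * lam - K"
  have C: "0 < C" using False by (simp add: C_def)
  have "(sqrt (a * C) - Q / 2) * T \<le> pi * real m - pi / 2"
  proof (rule period_lower_speed[OF _ a C q p _ per])
    fix t assume t: "t \<in> {0..T}"
    have "lam * h t \<le> lam * - \<eta>" using h[OF t] lam by (intro mult_left_mono) auto
    then show "C \<le> H t $ 2 $ 2 - H t $ 3 $ 3 * (H t $ 1 $ 3)\<^sup>2 - lam * h t"
      using D[OF t] by (simp add: C_def algebra_simps)
  qed (use T in auto)
  then have "(sqrt (a * C) - Q / 2) * T \<le> pi * real m" using pi_gt_zero by linarith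
  then have "sqrt (a * C) \<le> pi * real m / T + Q / 2"
    using T by (simp add: field_simps)
  then have "(sqrt (a * C))\<^sup>2 \<le> (pi * real m / T + Q / 2)\<^sup>2"
    using a C by (intro power_mono) auto
  then have "a * C \<le> (pi * real m / T + Q / 2)\<^sup>2" using a C by simp
  then have "C \<le> (pi * real m / T + Q / 2)\<^sup>2 / a" using a by (simp add: field_simps)
  then show ?thesis by (simp add: C_def)
qed

text \<open>For \<open>lam < 0\<close> the term \<open>- lam * h t\<close> may exceed \<open>lam * \<eta>\<close>. It is
  bounded by \<open>(lam + \<mu>) * \<eta>\<close>, whatever the sign of \<open>lam\<close>, and this shifted bound is
  positive, so that a balancing scale exists. The condition on \<open>m\<close> allows squaring.\<close>

lemma parameter_lower_bound:
  fixes H :: "real \<Rightarrow> real^3^3"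
  assumes T: "0 < T" and a: "0 < a" and \<eta>: "0 < \<eta>" and K: "0 < K" and \<mu>: "0 \<le> \<mu>" "- \<mu> < lam"
    and q: "\<And>t. t \<in> {0..T} \<Longrightarrow> \<bar>2 * H t $ 2 $ 1 + (H t $ 1 $ 3)\<^sup>2\<bar> \<le> Q"
    and p: "\<And>t. t \<in> {0..T} \<Longrightarrow> H t $ 1 $ 1 \<le> a"
    and D: "\<And>t. t \<in> {0..T} \<Longrightarrow> H t $ 2 $ 2 - H t $ 3 $ 3 * (H t $ 1 $ 3)\<^sup>2 \<le> K"
    and h: "\<And>t. t \<in> {0..T} \<Longrightarrow> - \<eta> \<le> h t \<and> h t \<le> 0"
    and per: "has_statistic_period T H h lam m"
    and m: "pi / (2 * T) + Q / 2 \<le> pi * real m / T"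
  shows "(pi * real m / T - (pi / (2 * T) + Q / 2))\<^sup>2 \<le> a * (K + (lam + \<mu>) * \<eta>)"
proof -
  define C where "C = K + (lam + \<mu>) * \<eta>"
  have C: "0 < C" using K \<mu> \<eta> by (simp add: C_def add_pos_nonneg)
  have "pi * real m - pi / 2 \<le> (sqrt (a * C) + Q / 2) * T"
  proof (rule period_upper_speed[OF _ a C q p _ per])
    fix t assume t: "t \<in> {0..T}"
    have "lam * - h t \<le> (lam + \<mu>) * - h t"
      using h[OF t] \<mu> by (intro mult_right_mono) auto
    also have "\<dots> \<le> (lam + \<mu>) * \<eta>"
      using h[OF t] \<mu> by (intro mult_left_mono) auto
    finally show "H t $ 2 $ 2 - H t $ 3 $ 3 * (H t $ 1 $ 3)\<^sup>2 - lam * h t \<le> C"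
      using D[OF t] by (simp add: C_def)
  qed (use T in auto)
  then have "pi * real m / T - (pi / (2 * T) + Q / 2) \<le> sqrt (a * C)"
    using T by (simp add: field_simps)
  then have "(pi * real m / T - (pi / (2 * T) + Q / 2))\<^sup>2 \<le> (sqrt (a * C))\<^sup>2"
    using m by (intro power_mono) auto
  then show ?thesis using a C by (simp add: C_def)
qed

section \<open>Asymptotics in the statistic period\<close>

lemma eventually_const_le_scaled:
  fixes c d :: real
  assumes "0 < d"
  shows "\<forall>\<^sub>F m in sequentially. c \<le> d * real m"
  using filterlim_tendsto_pos_mult_at_top[OF tendsto_const assms filterlim_real_sequentially]
  by (simp add: filterlim_at_top)

lemma eventually_const_le_scaled_square:
  fixes c d :: real
  assumes "0 < d"
  shows "\<forall>\<^sub>F m in sequentially. c \<le> d * (real m)\<^sup>2"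
proof -
  have "filterlim (\<lambda>m. d * (real m)\<^sup>2) at_top sequentially"
    by (intro filterlim_tendsto_pos_mult_at_top[OF tendsto_const assms] filterlim_pow_at_top
        filterlim_real_sequentially) simp
  then show ?thesis by (simp add: filterlim_at_top)
qed

lemma square_add_le: "(x + y)\<^sup>2 \<le> 2 * x\<^sup>2 + 2 * y\<^sup>2" for x y :: real
  using zero_le_power2[of "x - y"] by (simp add: power2_sum power2_diff)

lemma square_diff_ge: "3 / 4 * x\<^sup>2 - 3 * y\<^sup>2 \<le> (x - y)\<^sup>2" for x y :: real
  using zero_le_power2[of "x / 2 - 2 * y"] by (simp add: power2_diff power_divide power_mult_distrib)

text \<open>Half of the leading coefficient \<open>4\<close> bounds the square of the speed, the other half the
  terms that stay bounded as \<open>m\<close> grows.\<close>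

lemma eventually_upper_bound:
  assumes T: "0 < T" and a: "0 < a" and \<eta>: "0 < \<eta>"
  shows "\<forall>\<^sub>F m in sequentially.
    K + (pi * real m / T + c)\<^sup>2 / a \<le> \<eta> * (4 * pi\<^sup>2 * (real m)\<^sup>2 / (a * \<eta> * T\<^sup>2))"
proof -
  have "0 < 2 * pi\<^sup>2 / (a * T\<^sup>2)" using T a by simp
  from eventually_const_le_scaled_square[OF this, of "K + 2 * c\<^sup>2 / a"] show ?thesis
  proof eventually_elim
    case (elim m)
    have "(pi * real m / T + c)\<^sup>2 / a \<le> (2 * (pi * real m / T)\<^sup>2 + 2 * c\<^sup>2) / a"
      using square_add_le a by (intro divide_right_mono) auto
    also have "\<dots> = 2 * pi\<^sup>2 / (a * T\<^sup>2) * (real m)\<^sup>2 + 2 * c\<^sup>2 / a"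
      using T a by (simp add: field_simps)
    finally have "K + (pi * real m / T + c)\<^sup>2 / a \<le> 2 * (2 * pi\<^sup>2 / (a * T\<^sup>2) * (real m)\<^sup>2)"
      using elim by linarith
    also have "\<dots> = \<eta> * (4 * pi\<^sup>2 * (real m)\<^sup>2 / (a * \<eta> * T\<^sup>2))"
      using \<eta> by (simp add: field_simps)
    finally show ?case .
  qed
qed

text \<open>The square on the left is at least \<open>3/4\<close> of its leading term minus a constant; the claim
  uses up \<open>1/2\<close>, and the remaining \<open>1/4\<close> exceeds every constant.\<close>

lemma eventually_lower_bound:
  assumes T: "0 < T" and a: "0 < a" and \<eta>: "0 < \<eta>"
  shows "\<forall>\<^sub>F m in sequentially. \<forall>lam.
    (pi * real m / T - c)\<^sup>2 \<le> a * (K + (lam + \<mu>) * \<eta>) \<longrightarrow>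
    d + pi\<^sup>2 * (real m)\<^sup>2 / (2 * a * \<eta> * T\<^sup>2) \<le> lam"
proof -
  have "0 < pi\<^sup>2 / (4 * T\<^sup>2)" using T by simp
  from eventually_const_le_scaled_square[OF this, of "3 * c\<^sup>2 + a * (K + (\<mu> + d) * \<eta>)"]
  show ?thesis
  proof eventually_elim
    case (elim m)
    show ?case
    proof (intro allI impI)
      fix lam assume lam: "(pi * real m / T - c)\<^sup>2 \<le> a * (K + (lam + \<mu>) * \<eta>)"
      have x: "(pi * real m / T)\<^sup>2 = pi\<^sup>2 / T\<^sup>2 * (real m)\<^sup>2" by (simp add: field_simps)
      have "3 / 4 * (pi\<^sup>2 / T\<^sup>2 * (real m)\<^sup>2) - 3 * c\<^sup>2 \<le> a * (K + (lam + \<mu>) * \<eta>)"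
        using square_diff_ge[of "pi * real m / T" c] lam unfolding x by linarith
      moreover have "pi\<^sup>2 / (4 * T\<^sup>2) * (real m)\<^sup>2 = 1 / 4 * (pi\<^sup>2 / T\<^sup>2 * (real m)\<^sup>2)" by simp
      ultimately have "1 / 2 * (pi\<^sup>2 / T\<^sup>2 * (real m)\<^sup>2) \<le>
          a * (K + (lam + \<mu>) * \<eta>) - a * (K + (\<mu> + d) * \<eta>)"
        using elim by linarith
      also have "\<dots> = (a * \<eta>) * (lam - d)" by (simp add: algebra_simps)
      finally have "1 / 2 * (pi\<^sup>2 / T\<^sup>2 * (real m)\<^sup>2) / (a * \<eta>) \<le> lam - d"
        using mult_pos_pos[OF a \<eta>] by (metis pos_divide_le_eq mult.commute)
      moreover have "1 / 2 * (pi\<^sup>2 / T\<^sup>2 * (real m)\<^sup>2) / (a * \<eta>) =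
          pi\<^sup>2 * (real m)\<^sup>2 / (2 * a * \<eta> * T\<^sup>2)" by (simp add: field_simps)
      ultimately show "d + pi\<^sup>2 * (real m)\<^sup>2 / (2 * a * \<eta> * T\<^sup>2) \<le> lam" by linarith
    qed
  qed
qed

theorem theorem1p6:
  fixes M :: "'a measure" and B :: "real \<Rightarrow> 'a \<Rightarrow> real" and T :: real
    and H :: "real \<Rightarrow> real^3^3" and h22 :: "real \<Rightarrow> real"
    and H11_lo H11_hi H22_lo H22_hi H22_und H13_lo H13_hi H33_lo H33_hi H21_lo H21_hi
        h22_lo h22_hi H23_hi :: real
  assumes "standard_brownian_motion M B"
    and "0 < T"
    and "standing_assumptions T H h22"
    and "0 < H11_lo"
    and "\<And>t. t \<in> {0..T} \<Longrightarrow> H11_lo < H t $ 1 $ 1 \<and> H t $ 1 $ 1 < H11_hi"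
    and "\<And>t. t \<in> {0..T} \<Longrightarrow> H22_lo < H t $ 2 $ 2 \<and> H t $ 2 $ 2 < H22_hi"
    and "H22_hi < 0"
    and "0 \<le> H13_lo"
    and "\<And>t. t \<in> {0..T} \<Longrightarrow> H13_lo \<le> \<bar>H t $ 1 $ 3\<bar> \<and> \<bar>H t $ 1 $ 3\<bar> \<le> H13_hi"
    and "\<And>t. t \<in> {0..T} \<Longrightarrow> H33_lo < H t $ 3 $ 3 \<and> H t $ 3 $ 3 < H33_hi"
    and "H33_hi < 0"
    and "\<And>t. t \<in> {0..T} \<Longrightarrow> H21_lo \<le> H t $ 2 $ 1 \<and> H t $ 2 $ 1 \<le> H21_hi"
    and "\<And>t. t \<in> {0..T} \<Longrightarrow> h22_lo < h22 t \<and> h22 t < h22_hi"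
    and "h22_hi < 0"
    and "H23_hi = - H33_lo * H13_hi"
    and "H22_und < 0"
    and "\<exists>\<beta>>0. monotonicity \<beta>
           (vector [vector [H11_hi, H21_hi, H13_hi],
                    vector [H21_hi, H22_und, H23_hi],
                    vector [H13_hi, H23_hi, H33_lo]])"
  shows
    "(\<forall>\<^sub>F m in sequentially. \<forall>lam. eigenvalue_with_index M B T H h22 m lam \<longrightarrow>
        (H22_hi - H22_und) / h22_lo + pi\<^sup>2 * (real m)\<^sup>2 / (- 2 * H11_hi * h22_lo * T\<^sup>2) \<le> lam
        \<and> lam \<le> 4 * pi\<^sup>2 * (real m)\<^sup>2 / (- H11_lo * h22_hi * T\<^sup>2))
   \<and> (\<forall>\<^sub>F m in sequentially. \<forall>lam p.
        is_eigenvalue M B T H h22 lam \<and> lambda_b T H h22 < lam \<and> has_statistic_period T H h22 lam p \<longrightarrow>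
        (lam > 4 * pi\<^sup>2 * (real m)\<^sup>2 / (- H11_lo * h22_hi * T\<^sup>2) \<longrightarrow> p > m)
        \<and> (lam < (H22_hi - H22_und) / h22_lo + pi\<^sup>2 * (real m)\<^sup>2 / (- 2 * H11_hi * h22_lo * T\<^sup>2)
             \<longrightarrow> p < m))"
proof -
  define Q where "Q = 2 * (\<bar>H21_lo\<bar> + \<bar>H21_hi\<bar>) + H13_hi\<^sup>2"
  define Kl where "Kl = \<bar>H22_lo\<bar>"
  define Ku where "Ku = 1 + \<bar>H33_lo\<bar> * H13_hi\<^sup>2"
  define \<mu> where "\<mu> = \<bar>lambda_b T H h22\<bar>"
  define U where "U m = 4 * pi\<^sup>2 * (real m)\<^sup>2 / (- H11_lo * h22_hi * T\<^sup>2)" for m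
  define W where "W m = (H22_hi - H22_und) / h22_lo
    + pi\<^sup>2 * (real m)\<^sup>2 / (- 2 * H11_hi * h22_lo * T\<^sup>2)" for m
  have T: "0 < T" by fact
  have "0 \<in> {0..T}" using T by simp
  then have H11_hi: "0 < H11_hi" and h22_lo: "0 < - h22_lo"
    using assms(4) assms(5)[of 0] assms(13)[of 0] assms(14) by simp_all
  have h22_hi: "0 < - h22_hi" using assms(14) by simp
  have H13: "(H t $ 1 $ 3)\<^sup>2 \<le> H13_hi\<^sup>2" if "t \<in> {0..T}" for t
    using assms(9)[OF that] power_mono[of "\<bar>H t $ 1 $ 3\<bar>" H13_hi 2] by simp
  have q: "\<bar>2 * H t $ 2 $ 1 + (H t $ 1 $ 3)\<^sup>2\<bar> \<le> Q" if "t \<in> {0..T}" for t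
  proof -
    have "\<bar>H t $ 2 $ 1\<bar> \<le> \<bar>H21_lo\<bar> + \<bar>H21_hi\<bar>" using assms(12)[OF that] by linarith
    then have "\<bar>2 * H t $ 2 $ 1\<bar> + \<bar>(H t $ 1 $ 3)\<^sup>2\<bar> \<le> Q"
      using H13[OF that] by (simp add: Q_def abs_mult)
    then show ?thesis using abs_triangle_ineq order_trans by blast
  qed
  have D_lo: "- Kl \<le> H t $ 2 $ 2 - H t $ 3 $ 3 * (H t $ 1 $ 3)\<^sup>2" if "t \<in> {0..T}" for t
  proof -
    have "H t $ 3 $ 3 * (H t $ 1 $ 3)\<^sup>2 \<le> 0"
      using assms(10)[OF that] assms(11) by (intro mult_nonpos_nonneg) auto
    then show ?thesis using assms(6)[OF that] unfolding Kl_def by linarith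
  qed
  have D_hi: "H t $ 2 $ 2 - H t $ 3 $ 3 * (H t $ 1 $ 3)\<^sup>2 \<le> Ku" if "t \<in> {0..T}" for t
  proof -
    have "- H t $ 3 $ 3 * (H t $ 1 $ 3)\<^sup>2 \<le> \<bar>H33_lo\<bar> * H13_hi\<^sup>2"
      using assms(10)[OF that] assms(11) H13[OF that] by (intro mult_mono) auto
    then show ?thesis using assms(6)[OF that] assms(7) by (simp add: Ku_def)
  qed

  \<comment> \<open>This holds for every period, since in the claim on statistic periods \<open>p\<close> may be
    small while \<open>m\<close> is large.\<close>
  have upper: "- h22_hi * lam \<le> Kl + (pi * real p / T + Q / 2)\<^sup>2 / H11_lo"
    if "has_statistic_period T H h22 lam p" for lam p
    by (rule parameter_upper_bound[OF T assms(4) h22_hi _ q _ D_lo _ that])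
      (use assms(5,13) in \<open>auto simp: Kl_def intro: less_imp_le\<close>)
  have upper_period: "\<forall>\<^sub>F m in sequentially. \<forall>lam p.
      has_statistic_period T H h22 lam p \<and> p \<le> m \<longrightarrow> lam \<le> U m"
    using eventually_upper_bound[OF T assms(4) h22_hi, of Kl "Q / 2"]
  proof eventually_elim
    case (elim m)
    show ?case
    proof (intro allI impI)
      fix lam p assume p: "has_statistic_period T H h22 lam p \<and> p \<le> m"
      have "0 \<le> Q" using q[of 0] T by (smt (verit) abs_ge_zero atLeastAtMost_iff)
      moreover have "pi * real p / T \<le> pi * real m / T" "0 \<le> pi * real p / T"
        using p T by (auto intro!: divide_right_mono mult_left_mono)
      ultimately have "(pi * real p / T + Q / 2)\<^sup>2 / H11_lo \<le> (pi * real m / T + Q / 2)\<^sup>2 / H11_lo"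
        using assms(4) by (intro divide_right_mono power_mono) auto
      then have "- h22_hi * lam \<le> - h22_hi * U m"
        using upper[of lam p] p elim by (simp add: U_def)
      then show "lam \<le> U m" using h22_hi by simp
    qed
  qed

  have "\<forall>\<^sub>F m in sequentially. pi / (2 * T) + Q / 2 \<le> pi / T * real m"
    using T by (intro eventually_const_le_scaled) simp
  then have lower: "\<forall>\<^sub>F m in sequentially. \<forall>lam.
      lambda_b T H h22 < lam \<and> has_statistic_period T H h22 lam m \<longrightarrow> W m \<le> lam"
    using eventually_lower_bound[OF T H11_hi h22_lo, of "pi / (2 * T) + Q / 2" Ku \<mu>
        "(H22_hi - H22_und) / h22_lo"]
  proof eventually_elim
    case (elim m)
    show ?case
    proof (intro allI impI)
      fix lam assume lam: "lambda_b T H h22 < lam \<and> has_statistic_period T H h22 lam m"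
      have "(pi * real m / T - (pi / (2 * T) + Q / 2))\<^sup>2 \<le> H11_hi * (Ku + (lam + \<mu>) * - h22_lo)"
      proof (rule parameter_lower_bound[OF T H11_hi h22_lo _ _ _ q _ D_hi])
        show "0 < Ku" by (simp add: Ku_def add_pos_nonneg)
        show "0 \<le> \<mu>" "- \<mu> < lam" using lam by (auto simp: \<mu>_def)
        show "H t $ 1 $ 1 \<le> H11_hi" if "t \<in> {0..T}" for t using assms(5)[OF that] by simp
        show "- (- h22_lo) \<le> h22 t \<and> h22 t \<le> 0" if "t \<in> {0..T}" for t
          using assms(13)[OF that] assms(14) by simp
        show "has_statistic_period T H h22 lam m" using lam by simp
        show "pi / (2 * T) + Q / 2 \<le> pi * real m / T" using elim(1) by simp
      qed
      then show "W m \<le> lam" using elim(2) by (simp add: W_def)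
    qed
  qed

  have W_mono: "W m \<le> W p" if "m \<le> p" for m p
  proof -
    have "0 < - 2 * H11_hi * h22_lo * T\<^sup>2"
      using mult_pos_pos[OF H11_hi h22_lo] T by (simp add: mult_neg_pos)
    then show ?thesis
      unfolding W_def using that
      by (intro add_left_mono divide_right_mono mult_left_mono power_mono) auto
  qed
  have lower_period: "\<forall>\<^sub>F m in sequentially. \<forall>lam p.
      lambda_b T H h22 < lam \<and> has_statistic_period T H h22 lam p \<and> m \<le> p \<longrightarrow> W m \<le> lam"
  proof -
    obtain N where "\<forall>m\<ge>N. \<forall>lam.
        lambda_b T H h22 < lam \<and> has_statistic_period T H h22 lam m \<longrightarrow> W m \<le> lam"
      using lower by (auto simp: eventually_sequentially)
    then have "\<forall>m\<ge>N. \<forall>lam p.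
        lambda_b T H h22 < lam \<and> has_statistic_period T H h22 lam p \<and> m \<le> p \<longrightarrow> W m \<le> lam"
      using W_mono by (meson order_trans)
    then show ?thesis by (auto simp: eventually_sequentially)
  qed

  show ?thesis
    unfolding U_def[symmetric] W_def[symmetric]
  proof
    show "\<forall>\<^sub>F m in sequentially. \<forall>lam. eigenvalue_with_index M B T H h22 m lam \<longrightarrow>
        W m \<le> lam \<and> lam \<le> U m"
      using upper_period lower_period
      by eventually_elim (auto simp: eigenvalue_with_index_def)
    show "\<forall>\<^sub>F m in sequentially. \<forall>lam p.
        is_eigenvalue M B T H h22 lam \<and> lambda_b T H h22 < lam \<and> has_statistic_period T H h22 lam p
        \<longrightarrow> (lam > U m \<longrightarrow> p > m) \<and> (lam < W m \<longrightarrow> p < m)"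
      using upper_period lower_period
      by eventually_elim (meson not_le)
  qed
qed

end
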